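(* Let $A,B\in\mathbb{C}^{m\times m}$ be nonsingular, and let $x_1,\ldots,x_p\in\mathbb{C}$, $Y_1,\ldots,Y_p\in\mathbb{C}^{m\times m}$ be a feasible data set (with respect to $A,B$). Let, after renumbering, $x_1,\ldots,x_n$ ($n\le p$), with the corresponding $Y_1,\ldots,Y_n$, be a corresponding reduced data set. Then there always exists a polynomial $P(s)=\sum_{k=0}^{q-1}C_ks^k$, $C_k\in\mathbb{C}^{m\times m}$, satisfying $$P^{\#}(s)=A\,P(s)\,B \qquad\text{and}\qquad P(x_j)=Y_j,\quad j=1,\ldots,p,$$ with $$2n\ge q.$$ The coefficients $C_0,\ldots,C_{2n-1}$ are obtained from the matrix equation $\mathbf{X}\mathbf{C}=\mathbf{Y}$, where both $$\mathbf{C}:=\begin{pmatrix}C_0\\ \vdots\\ C_{2n-1}\end{pmatrix},\qquad \mathbf{Y}:=\begin{pmatrix}Y_1\\ \vdots\\ Y_n\\ (AY_1B)^*\\ \vdots\\ (AY_nB)^*\end{pmatrix}$$ are of dimension $2nm\times m$, and $\mathbf{X}$ is the $2nm\times 2nm$ block-Vandermonde matrix whose $j$-th block row, for $1\le j\le n$, is $$\left(I_m,\ x_jI_m,\ x_j^2I_m,\ \ldots,\ x_j^{2n-1}I_m\right)$$ and whose $(n+j)$-th block row, for $1\le j\le n$, is $$\left(I_m,\ -x_j^*I_m,\ (-x_j^* )^2I_m,\ \ldots,\ (-x_j^* )^{2n-1}I_m\right).$$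
   Context: For a complex number $x$, $x^*$ denotes the complex conjugate; for a matrix, $^*$ is the conjugate transpose; $I_m$ is the $m\times m$ identity. For a function $F:\mathbb{C}\to\mathbb{C}^{m\times m}$, $F^{\#}(s):=\left(F(-s^* )\right)^*$. Data $x_1,\ldots,x_p\in\mathbb{C}$, $Y_1,\ldots,Y_p\in\mathbb{C}^{m\times m}$ is called feasible (with respect to $A,B$) if for all $1\le j<k\le p$: $x_j-x_k=0$ implies $Y_j=Y_k$, and $x_j+x_k^*=0$ implies $Y_j=(AY_kB)^*$. A reduced data set is obtained by extracting from the feasible nodes $x_1,\ldots,x_p$ a maximal subset, renumbered $x_1,\ldots,x_n$ (with the corresponding $Y_1,\ldots,Y_n$), such that $x_j-x_k\ne 0$ and $x_j+x_k^*\neq 0$ for all $1\le j<k\le n$.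
   Formalization: The data are additionally assumed to satisfy Y_j=(A(AY_jB)^*B)^* for every j, and Y_j=(AY_jB)^* whenever x_j+x_j^*=0; both are necessary for P to exist and do not follow from feasibility as stated. *)

theory Defs
  imports "Jordan_Normal_Form.Schur_Decomposition"
begin

text \<open>Nodes, data matrices and block indices are numbered from 0, so the data set is
  \<open>x 0, \<dots>, x (p - 1)\<close> and \<open>Y 0, \<dots>, Y (p - 1)\<close>.\<close>

definition sharp :: "(complex \<Rightarrow> complex mat) \<Rightarrow> complex \<Rightarrow> complex mat" where
  "sharp F s = mat_adjoint (F (- cnj s))"

text \<open>The type of matrices of arbitrary size has no zero and so no \<open>sum\<close>; the sum
  \<open>C 0 + s C 1 + \<dots> + s^(q-1) C (q-1)\<close> is taken entrywise.\<close>

definition matpoly :: "nat \<Rightarrow> nat \<Rightarrow> (nat \<Rightarrow> complex mat) \<Rightarrow> complex \<Rightarrow> complex mat" where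
  "matpoly m q C s = mat m m (\<lambda>(i, j). \<Sum>k<q. C k $$ (i, j) * s ^ k)"

definition feasible ::
    "complex mat \<Rightarrow> complex mat \<Rightarrow> nat \<Rightarrow> (nat \<Rightarrow> complex) \<Rightarrow> (nat \<Rightarrow> complex mat) \<Rightarrow> bool" where
  "feasible A B p x Y \<longleftrightarrow>
     (\<forall>j k. j < k \<and> k < p \<longrightarrow>
        (x j - x k = 0 \<longrightarrow> Y j = Y k) \<and>
        (x j + cnj (x k) = 0 \<longrightarrow> Y j = mat_adjoint (A * Y k * B)))"

text \<open>Both relations below are symmetric in \<open>j\<close> and \<open>k\<close>, so ordered pairs \<open>j < k\<close> of any
  renumbering of \<open>S\<close> amount to distinct indices. A purely imaginary node is not excluded.\<close>

definition independent_nodes :: "(nat \<Rightarrow> complex) \<Rightarrow> nat set \<Rightarrow> bool" where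
  "independent_nodes x S \<longleftrightarrow>
     (\<forall>j\<in>S. \<forall>k\<in>S. j \<noteq> k \<longrightarrow> x j - x k \<noteq> 0 \<and> x j + cnj (x k) \<noteq> 0)"

definition reduced_index_set :: "nat \<Rightarrow> (nat \<Rightarrow> complex) \<Rightarrow> nat set \<Rightarrow> bool" where
  "reduced_index_set p x S \<longleftrightarrow>
     S \<subseteq> {..<p} \<and> independent_nodes x S \<and>
     (\<forall>T. S \<subset> T \<and> T \<subseteq> {..<p} \<longrightarrow> \<not> independent_nodes x T)"

definition block_mat ::
    "nat \<Rightarrow> nat \<Rightarrow> nat \<Rightarrow> (nat \<Rightarrow> nat \<Rightarrow> complex mat) \<Rightarrow> complex mat" where
  "block_mat m nr nc F =
     mat (nr * m) (nc * m) (\<lambda>(i, j). F (i div m) (j div m) $$ (i mod m, j mod m))"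

definition block_vandermonde :: "nat \<Rightarrow> nat \<Rightarrow> (nat \<Rightarrow> complex) \<Rightarrow> complex mat" where
  "block_vandermonde m n x =
     block_mat m (2 * n) (2 * n)
       (\<lambda>j k. if j < n then x j ^ k \<cdot>\<^sub>m 1\<^sub>m m else (- cnj (x (j - n))) ^ k \<cdot>\<^sub>m 1\<^sub>m m)"

definition coefficient_column :: "nat \<Rightarrow> nat \<Rightarrow> (nat \<Rightarrow> complex mat) \<Rightarrow> complex mat" where
  "coefficient_column m n C = block_mat m (2 * n) 1 (\<lambda>k _. C k)"

definition data_column ::
    "complex mat \<Rightarrow> complex mat \<Rightarrow> nat \<Rightarrow> nat \<Rightarrow> (nat \<Rightarrow> complex mat) \<Rightarrow> complex mat" where
  "data_column A B m n Y =
     block_mat m (2 * n) 1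
       (\<lambda>j _. if j < n then Y j else mat_adjoint (A * Y (j - n) * B))"

text \<open>If \<open>F\<close> satisfies \<open>sharp F s = A * F s * B\<close> for all \<open>s\<close>, applying the identity twice gives
  \<open>F s = mat_adjoint (A * mat_adjoint (A * F s * B) * B)\<close>, and at a purely imaginary \<open>s\<close> it
  gives \<open>F s = mat_adjoint (A * F s * B)\<close>. Hence every single node must satisfy the conditions
  below, and they do not follow from \<open>feasible\<close>, which only compares different indices: for \<open>m = 1\<close>,
  \<open>A = 2\<close>, \<open>B = 1\<close>, the feasible one-point data set \<open>x = 1\<close>, \<open>Y = 1\<close> has no interpolant with
  the symmetry, and likewise for \<open>A = B = 1\<close>, \<open>x = 0\<close>, \<open>Y = \<i>\<close>.\<close>

definition nodewise_consistent ::
    "complex mat \<Rightarrow> complex mat \<Rightarrow> nat \<Rightarrow> (nat \<Rightarrow> complex) \<Rightarrow> (nat \<Rightarrow> complex mat) \<Rightarrow> bool" where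
  "nodewise_consistent A B p x Y \<longleftrightarrow>
     (\<forall>j<p. Y j = mat_adjoint (A * mat_adjoint (A * Y j * B) * B) \<and>
            (x j + cnj (x j) = 0 \<longrightarrow> Y j = mat_adjoint (A * Y j * B)))"

end

theory Submission
  imports Defs
begin

text \<open>The conditions on the data say precisely that the assignment of \<open>Y j\<close> to \<open>x j\<close> and of
  \<open>(A Y j B)\<^sup>*\<close> to \<open>- (x j)\<^sup>*\<close> is a well-defined function \<open>W\<close> on a finite set \<open>V\<close> that is closed
  under the reflection \<open>v \<mapsto> - v\<^sup>*\<close>, and that \<open>W (- v\<^sup>*) = (A (W v) B)\<^sup>*\<close>. By maximality of the
  reduced set its nodes and their reflections already exhaust \<open>V\<close>, so \<open>V\<close> has at most \<open>2 n\<close>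
  elements. Conjugation together with the reflection permutes the Lagrange basis polynomials of \<open>V\<close>
  in the same way as the reflection permutes \<open>V\<close>, so the Lagrange interpolant of \<open>W\<close> inherits the
  symmetry of \<open>W\<close>.\<close>

section \<open>Lagrange basis polynomials and their behaviour under reflection\<close>

definition lagrange_basis :: "'a::field set \<Rightarrow> 'a \<Rightarrow> 'a poly" where
  "lagrange_basis V v = (\<Prod>w\<in>V - {v}. smult (inverse (v - w)) [:- w, 1:])"

lemma poly_lagrange_basis:
  "poly (lagrange_basis V v) s = (\<Prod>w\<in>V - {v}. inverse (v - w) * (s - w))"
  by (simp add: lagrange_basis_def poly_prod algebra_simps)

lemma poly_lagrange_basis_node:
  assumes "finite V" "u \<in> V"
  shows "poly (lagrange_basis V v) u = (if u = v then 1 else 0)"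
proof (cases "u = v")
  case True
  have "(\<Prod>w\<in>V - {v}. inverse (v - w) * (v - w)) = 1"
    by (intro prod.neutral ballI) (auto intro!: left_inverse)
  then show ?thesis using True by (simp only: poly_lagrange_basis simp_thms if_True)
next
  case False
  then have "u \<in> V - {v}" "inverse (v - u) * (u - u) = 0"
    using assms by auto
  then show ?thesis
    unfolding poly_lagrange_basis using False assms(1)
    by (simp only: if_False, intro prod_zero) auto
qed

lemma degree_lagrange_basis_less:
  assumes "finite V" "v \<in> V"
  shows "degree (lagrange_basis V v) < card V"
proof -
  have "degree (lagrange_basis V v) \<le>
      (\<Sum>w\<in>V - {v}. degree (smult (inverse (v - w)) [:- w, 1:]))"
    unfolding lagrange_basis_def using assms by (intro degree_prod_sum_le[unfolded o_def]) auto
  also have "\<dots> \<le> (\<Sum>w\<in>V - {v}. 1)"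
    by (intro sum_mono) auto
  also have "\<dots> < card V"
    using card_Diff1_less[OF assms] by simp
  finally show ?thesis .
qed

lemma poly_eq_sum_lessThan:
  fixes p :: "'a::comm_semiring_1 poly"
  assumes "degree p < q"
  shows "poly p s = (\<Sum>k<q. coeff p k * s ^ k)"
  unfolding poly_altdef using assms
  by (intro sum.mono_neutral_left) (auto simp: coeff_eq_0)

text \<open>The product is reindexed by \<open>w \<mapsto> - cnj w\<close>. Conjugation then leaves
  a sign in both \<open>v - w\<close> and \<open>s - w\<close>, and the two signs cancel factor by
  factor, so no power of -1 depending on the number of nodes survives.\<close>

lemma cnj_poly_lagrange_basis_reflect:
  assumes "\<And>v. v \<in> V \<Longrightarrow> - cnj v \<in> V"
  shows "cnj (poly (lagrange_basis V (- cnj v)) (- cnj s)) = poly (lagrange_basis V v) s"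
proof -
  have "bij_betw (\<lambda>w. - cnj w) (V - {v}) (V - {- cnj v})"
    by (rule bij_betwI[where g = "\<lambda>w. - cnj w"]) (use assms in auto)
  then have "poly (lagrange_basis V (- cnj v)) (- cnj s) =
      (\<Prod>w\<in>V - {v}. inverse (- cnj v - - cnj w) * (- cnj s - - cnj w))"
    unfolding poly_lagrange_basis by (rule prod.reindex_bij_betw[symmetric])
  moreover have "cnj (inverse (- cnj v - - cnj w) * (- cnj s - - cnj w)) =
      inverse (v - w) * (s - w)" for w
  proof -
    have "cnj (inverse (- cnj v - - cnj w) * (- cnj s - - cnj w)) =
        inverse (- (v - w)) * (- (s - w))"
      by simp
    then show ?thesis by (simp only: inverse_minus_eq minus_mult_minus)
  qed
  ultimately show ?thesis
    unfolding poly_lagrange_basis by (simp only: cnj_prod)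
qed

section \<open>Entries of adjoints and of triple products\<close>

lemma mat_adjoint_carrier:
  assumes "M \<in> carrier_mat nr nc"
  shows "mat_adjoint M \<in> carrier_mat nc nr"
  using assms by (auto simp: mat_adjoint_def)

lemma mat_adjoint_index:
  assumes "M \<in> carrier_mat nr nc" "i < nc" "j < nr"
  shows "mat_adjoint M $$ (i, j) = cnj (M $$ (j, i))"
  using assms by (auto simp: mat_adjoint_def mat_of_rows_def)

text \<open>Shows the entry as linear in the entries of \<open>Z\<close>, which later lets the sum
  over the nodes pass through \<open>A * _ * B\<close>.\<close>

lemma mult_mat3_index:
  assumes "A \<in> carrier_mat m m" "Z \<in> carrier_mat m m" "B \<in> carrier_mat m m" "i < m" "j < m"
  shows "(A * Z * B) $$ (i, j) =
    (\<Sum>l<m. \<Sum>k<m. A $$ (i, k) * Z $$ (k, l) * B $$ (l, j))"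
proof -
  have "(A * Z * B) $$ (i, j) = (\<Sum>l<m. (A * Z) $$ (i, l) * B $$ (l, j))"
    using assms by (simp add: scalar_prod_def atLeast0LessThan del: assoc_mult_mat)
  also have "\<dots> = (\<Sum>l<m. \<Sum>k<m. A $$ (i, k) * Z $$ (k, l) * B $$ (l, j))"
    using assms by (simp add: scalar_prod_def atLeast0LessThan sum_distrib_right)
  finally show ?thesis .
qed

section \<open>The matrix-valued Lagrange interpolant and its symmetry\<close>

definition lagrange_coeff ::
    "nat \<Rightarrow> complex set \<Rightarrow> (complex \<Rightarrow> complex mat) \<Rightarrow> nat \<Rightarrow> complex mat" where
  "lagrange_coeff m V W k =
     mat m m (\<lambda>(i, j). \<Sum>v\<in>V. coeff (lagrange_basis V v) k * W v $$ (i, j))"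

text \<open>Every basis polynomial has degree below \<open>card V\<close>. This later pads the
  coefficient list with zeros up to length \<open>2 * n\<close>.\<close>

lemma lagrange_coeff_eq_0:
  assumes "finite V" "card V \<le> k"
  shows "lagrange_coeff m V W k = 0\<^sub>m m m"
proof -
  have "coeff (lagrange_basis V v) k = 0" if "v \<in> V" for v
    using degree_lagrange_basis_less[OF assms(1) that] assms(2) by (intro coeff_eq_0) simp
  then show ?thesis
    by (intro eq_matI) (auto simp: lagrange_coeff_def intro!: sum.neutral)
qed

lemma matpoly_lagrange_coeff:
  assumes "finite V"
  shows "matpoly m (card V) (lagrange_coeff m V W) s =
    mat m m (\<lambda>(i, j). \<Sum>v\<in>V. poly (lagrange_basis V v) s * W v $$ (i, j))"
proof (rule eq_matI, goal_cases)
  case (1 i j)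
  then have ij: "i < m" "j < m" by auto
  have "matpoly m (card V) (lagrange_coeff m V W) s $$ (i, j) =
      (\<Sum>k<card V. \<Sum>v\<in>V. coeff (lagrange_basis V v) k * s ^ k * W v $$ (i, j))"
    using ij by (simp add: matpoly_def lagrange_coeff_def sum_distrib_left mult_ac)
  also have "\<dots> = (\<Sum>v\<in>V. \<Sum>k<card V. coeff (lagrange_basis V v) k * s ^ k * W v $$ (i, j))"
    by (rule sum.swap)
  also have "\<dots> = (\<Sum>v\<in>V. poly (lagrange_basis V v) s * W v $$ (i, j))"
    using degree_lagrange_basis_less[OF assms]
    by (intro sum.cong refl)
       (simp add: poly_eq_sum_lessThan[where q = "card V"] sum_distrib_right)
  finally show ?case using ij by simp
qed (auto simp: matpoly_def)

lemma matpoly_lagrange_coeff_node: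
  assumes "finite V" "u \<in> V" "W u \<in> carrier_mat m m"
  shows "matpoly m (card V) (lagrange_coeff m V W) u = W u"
  unfolding matpoly_lagrange_coeff[OF assms(1)]
  using assms
  by (intro eq_matI) (auto simp: poly_lagrange_basis_node if_distrib[where f = "\<lambda>c. c * _"]
      cong: if_cong)

lemma sharp_matpoly_lagrange_coeff:
  assumes V: "finite V" "\<And>v. v \<in> V \<Longrightarrow> - cnj v \<in> V"
    and A: "A \<in> carrier_mat m m" and B: "B \<in> carrier_mat m m"
    and W: "\<And>v. v \<in> V \<Longrightarrow> W v \<in> carrier_mat m m"
    and W_reflect: "\<And>v. v \<in> V \<Longrightarrow> W (- cnj v) = mat_adjoint (A * W v * B)"
  shows "sharp (matpoly m (card V) (lagrange_coeff m V W)) s =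
    A * matpoly m (card V) (lagrange_coeff m V W) s * B"
proof -
  define L where "L = (\<lambda>v. poly (lagrange_basis V v))"
  define P where "P = (\<lambda>s. mat m m (\<lambda>(i, j). \<Sum>v\<in>V. L v s * W v $$ (i, j)))"
  have P_carrier: "P s \<in> carrier_mat m m" for s
    by (simp add: P_def)
  have reflect: "bij_betw (\<lambda>v. - cnj v) V V"
    by (rule bij_betwI[where g = "\<lambda>v. - cnj v"]) (use V(2) in auto)
  have "mat_adjoint (P (- cnj s)) = A * P s * B"
  proof (rule eq_matI, goal_cases)
    case (1 i j)
    then have ij: "i < m" "j < m" using A B by auto
    have "mat_adjoint (P (- cnj s)) $$ (i, j) =
        cnj (\<Sum>v\<in>V. L v (- cnj s) * W v $$ (j, i))"
      unfolding mat_adjoint_index[OF P_carrier ij] using ij by (simp add: P_def)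
    \<comment> \<open>The reflection permutes \<open>V\<close>, so the term at \<open>v\<close> may
      be replaced by the one at \<open>- cnj v\<close>, where both symmetry facts apply.\<close>
    also have "\<dots> = cnj (\<Sum>v\<in>V. L (- cnj v) (- cnj s) * W (- cnj v) $$ (j, i))"
      by (rule arg_cong[OF sum.reindex_bij_betw[OF reflect, symmetric]])
    also have "\<dots> = (\<Sum>v\<in>V. L v s * (A * W v * B) $$ (i, j))"
    proof -
      have "cnj (L (- cnj v) (- cnj s) * W (- cnj v) $$ (j, i)) = L v s * (A * W v * B) $$ (i, j)"
        if "v \<in> V" for v
      proof -
        have AWB: "A * W v * B \<in> carrier_mat m m"
          using A B W[OF that] by simp
        have "cnj (L (- cnj v) (- cnj s)) = L v s"
          unfolding L_def using V(2) by (rule cnj_poly_lagrange_basis_reflect)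
        moreover have "cnj (W (- cnj v) $$ (j, i)) = (A * W v * B) $$ (i, j)"
          unfolding W_reflect[OF that] mat_adjoint_index[OF AWB ij(2,1)] by simp
        ultimately show ?thesis by (simp only: complex_cnj_mult)
      qed
      then show ?thesis
        unfolding cnj_sum by (intro sum.cong refl)
    qed
    \<comment> \<open>The scalar \<open>L v s\<close> is moved next to \<open>W v\<close>, so that
      bringing the sum over \<open>v\<close> innermost produces an entry of
      \<open>P s\<close>.\<close>
    also have "\<dots> = (\<Sum>v\<in>V. \<Sum>l<m. \<Sum>k<m. A $$ (i, k) * (L v s * W v $$ (k, l)) * B $$ (l, j))"
      using W A B ij
      by (intro sum.cong refl)
         (simp add: mult_mat3_index sum_distrib_left mult_ac del: index_mult_mat)
    also have "\<dots> = (\<Sum>l<m. \<Sum>k<m. \<Sum>v\<in>V. A $$ (i, k) * (L v s * W v $$ (k, l)) * B $$ (l, j))"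
      by (subst sum.swap, intro sum.cong refl, rule sum.swap)
    also have "\<dots> = (\<Sum>l<m. \<Sum>k<m. A $$ (i, k) * P s $$ (k, l) * B $$ (l, j))"
      by (simp add: P_def sum_distrib_left sum_distrib_right)
    also have "\<dots> = (A * P s * B) $$ (i, j)"
      using mult_mat3_index[OF A P_carrier B ij] by simp
    finally show ?case .
  qed (use A B mat_adjoint_carrier[OF P_carrier] in auto)
  then show ?thesis
    unfolding sharp_def matpoly_lagrange_coeff[OF V(1)] P_def L_def .
qed

section \<open>Consequences of feasibility and of maximality of the reduced set\<close>

lemma feasible_eq:
  assumes "feasible A B p x Y" "j < p" "k < p" "x j = x k"
  shows "Y j = Y k"
  using assms unfolding feasible_def by (cases j k rule: linorder_cases) force+

text \<open>Feasibility settles only \<open>j < k\<close>. For \<open>j = k\<close> the node is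
  purely imaginary and its own consistency condition applies; for \<open>j > k\<close> the
  feasibility relation comes out with \<open>j\<close> and \<open>k\<close> exchanged and is
  inverted by the double-application condition.\<close>

lemma feasible_reflect:
  assumes "feasible A B p x Y" "nodewise_consistent A B p x Y" "j < p" "k < p"
    and "x j = - cnj (x k)"
  shows "Y j = mat_adjoint (A * Y k * B)"
proof (cases j k rule: linorder_cases)
  case less
  then show ?thesis using assms by (simp add: feasible_def)
next
  case equal
  moreover have "x k + cnj (x k) = 0" using equal assms(5) by (metis add.left_inverse)
  ultimately show ?thesis using assms(2,4) by (simp add: nodewise_consistent_def)
next
  case greater
  have "Y k = mat_adjoint (A * Y j * B)"
    using assms greater by (simp add: feasible_def)
  then show ?thesis using assms(2,3) unfolding nodewise_consistent_def by metis
qed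

text \<open>By maximality, adding a further index \<open>j\<close> to \<open>S\<close> destroys
  independence; as \<open>S\<close> itself is independent, the clash is between \<open>j\<close> and
  an element of \<open>S\<close>.\<close>

lemma reduced_index_set_covers:
  assumes "reduced_index_set p x S" "j < p"
  obtains k where "k \<in> S" "x j = x k \<or> x j = - cnj (x k)"
proof (cases "j \<in> S")
  case True
  then show ?thesis using that by blast
next
  case False
  then have "\<not> independent_nodes x (insert j S)" "independent_nodes x S"
    using assms unfolding reduced_index_set_def by blast+
  then obtain k where "k \<in> S"
    "x j = x k \<or> x j + cnj (x k) = 0 \<or> x k + cnj (x j) = 0"
    using False unfolding independent_nodes_def by fastforce
  moreover have "x k + cnj (x j) = 0 \<longleftrightarrow> x j + cnj (x k) = 0"
    by (auto simp: complex_eq_iff)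
  ultimately show ?thesis using that by (metis add_eq_0_iff2)
qed

section \<open>The block-Vandermonde system as evaluation at the nodes\<close>

lemma block_vandermonde_mult_coefficient_column:
  assumes "\<And>k. k < 2 * n \<Longrightarrow> C k \<in> carrier_mat m m"
  shows "block_vandermonde m n x * coefficient_column m n C =
    block_mat m (2 * n) 1
      (\<lambda>j _. matpoly m (2 * n) C (if j < n then x j else - cnj (x (j - n))))"
proof (rule eq_matI, goal_cases)
  case (1 i j)
  then have i: "i < 2 * n * m" and j: "j < m"
    by (auto simp: block_mat_def)
  then have m: "m > 0" and im: "i mod m < m"
    by auto
  have index_bound: "k * m + t < 2 * n * m" if "k < 2 * n" "t < m" for k t
  proof -
    have "k * m + t < Suc k * m" using that by simp
    also have "\<dots> \<le> 2 * n * m" using that by (intro mult_le_mono1) simp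
    finally show ?thesis .
  qed
  define z where "z = (if i div m < n then x (i div m) else - cnj (x (i div m - n)))"
  have "(block_vandermonde m n x * coefficient_column m n C) $$ (i, j) =
      (\<Sum>l<2 * n * m. (z ^ (l div m) \<cdot>\<^sub>m 1\<^sub>m m) $$ (i mod m, l mod m) * C (l div m) $$ (l mod m, j))"
    using i j unfolding block_vandermonde_def coefficient_column_def block_mat_def z_def
    by (auto simp: scalar_prod_def atLeast0LessThan intro!: sum.cong)
  \<comment> \<open>The flat column index is split as \<open>k * m + t\<close> into block number and
    position within the block.\<close>
  also have "\<dots> = (\<Sum>k<2 * n. \<Sum>t<m. (z ^ k \<cdot>\<^sub>m 1\<^sub>m m) $$ (i mod m, t) * C k $$ (t, j))"
    unfolding sum.cartesian_product
    by (rule sum.reindex_bij_witness[where i = "\<lambda>(k, t). k * m + t" and j = "\<lambda>l. (l div m, l mod m)"])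
       (use m index_bound in \<open>auto simp: less_mult_imp_div_less\<close>)
  also have "\<dots> = (\<Sum>k<2 * n. C k $$ (i mod m, j) * z ^ k)"
  proof (intro sum.cong refl)
    fix k
    have "(\<Sum>t<m. (z ^ k \<cdot>\<^sub>m 1\<^sub>m m) $$ (i mod m, t) * C k $$ (t, j)) =
        (\<Sum>t<m. if t = i mod m then z ^ k * C k $$ (t, j) else 0)"
      using im by (intro sum.cong refl) auto
    then show "(\<Sum>t<m. (z ^ k \<cdot>\<^sub>m 1\<^sub>m m) $$ (i mod m, t) * C k $$ (t, j)) =
        C k $$ (i mod m, j) * z ^ k"
      using im by simp
  qed
  also have "\<dots> = matpoly m (2 * n) C z $$ (i mod m, j)"
    using im j by (simp add: matpoly_def)
  finally show ?case
    using i j by (simp add: block_mat_def z_def)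
qed (auto simp: block_vandermonde_def coefficient_column_def block_mat_def)

lemma matpoly_extend:
  assumes "q \<le> q'" "\<And>k. q \<le> k \<Longrightarrow> k < q' \<Longrightarrow> C k = 0\<^sub>m m m"
  shows "matpoly m q' C s = matpoly m q C s"
proof -
  have "(\<Sum>k<q'. C k $$ (i, j) * s ^ k) = (\<Sum>k<q. C k $$ (i, j) * s ^ k)"
      if "i < m" "j < m" for i j
    using assms that by (intro sum.mono_neutral_right) auto
  then show ?thesis
    unfolding matpoly_def by (intro cong_mat) auto
qed

section \<open>The symmetric interpolant of the given data\<close>

theorem proposition3p1:
  fixes m p n :: nat
    and A B :: "complex mat"
    and x :: "nat \<Rightarrow> complex"
    and Y :: "nat \<Rightarrow> complex mat"
    and S :: "nat set"
    and r :: "nat \<Rightarrow> nat"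
  assumes A: "A \<in> carrier_mat m m" "invertible_mat A"
    and B: "B \<in> carrier_mat m m" "invertible_mat B"
    and Y: "\<And>j. j < p \<Longrightarrow> Y j \<in> carrier_mat m m"
    and feasible: "feasible A B p x Y"
    and consistent: "nodewise_consistent A B p x Y"
    and reduced: "reduced_index_set p x S"
    and renumbering: "bij_betw r {..<n} S"
  shows "\<exists>q C. q \<le> 2 * n \<and>
           (\<forall>k<2 * n. C k \<in> carrier_mat m m) \<and>
           (\<forall>k. q \<le> k \<and> k < 2 * n \<longrightarrow> C k = 0\<^sub>m m m) \<and>
           (\<forall>s. sharp (matpoly m q C) s = A * matpoly m q C s * B) \<and>
           (\<forall>j<p. matpoly m q C (x j) = Y j) \<and>
           block_vandermonde m n (x \<circ> r) * coefficient_column m n C =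
             data_column A B m n (Y \<circ> r)"
proof -
  define \<tau> where "\<tau> = (\<lambda>Z. mat_adjoint (A * Z * B))"
  define V where "V = x ` {..<p} \<union> (\<lambda>j. - cnj (x j)) ` {..<p}"
  \<comment> \<open>Nodes take precedence over reflected nodes. The choice made by
    \<open>SOME\<close> is immaterial by feasibility, and values outside \<open>V\<close> are
    arbitrary.\<close>
  define W where "W = (\<lambda>v. if \<exists>j<p. x j = v then Y (SOME j. j < p \<and> x j = v)
    else \<tau> (Y (SOME j. j < p \<and> - cnj (x j) = v)))"
  define C where "C = lagrange_coeff m V W"
  \<comment> \<open>For general \<open>A\<close> and \<open>B\<close> the map \<open>\<tau>\<close>
    is no involution on all matrices; it is one on the data by the consistency hypothesis.\<close>
  have \<tau>_\<tau>: "\<tau> (\<tau> (Y j)) = Y j" if "j < p" for j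
    using consistent that by (simp add: nodewise_consistent_def \<tau>_def)
  have \<tau>_carrier: "\<tau> Z \<in> carrier_mat m m" if "Z \<in> carrier_mat m m" for Z
    using that A(1) B(1) by (auto simp: \<tau>_def intro!: mat_adjoint_carrier)
  have W_node: "W (x j) = Y j" if "j < p" for j
  proof -
    have "(SOME k. k < p \<and> x k = x j) < p \<and> x (SOME k. k < p \<and> x k = x j) = x j"
      by (rule someI[of _ j]) (simp add: that)
    then have "Y (SOME k. k < p \<and> x k = x j) = Y j"
      using feasible_eq[OF feasible] that by blast
    then show ?thesis using that by (auto simp: W_def)
  qed
  have W_reflected_node: "W (- cnj (x j)) = \<tau> (Y j)" if "j < p" for j
  proof (cases "\<exists>k<p. x k = - cnj (x j)")
    \<comment> \<open>The reflected point is itself a node, so \<open>W\<close> returns the datum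
      \<open>Y k\<close> there, which must agree with \<open>\<tau> (Y j)\<close>.\<close>
    case True
    then obtain k where k: "k < p" "x k = - cnj (x j)" by blast
    then have "Y k = \<tau> (Y j)"
      unfolding \<tau>_def using feasible_reflect[OF feasible consistent] that by blast
    then show ?thesis using W_node k by metis
  next
    case False
    define l where "l = (SOME k. k < p \<and> - cnj (x k) = - cnj (x j))"
    have "l < p \<and> - cnj (x l) = - cnj (x j)"
      unfolding l_def by (rule someI[of _ j]) (simp add: that)
    then have "l < p" "x l = x j" by simp_all
    then have "Y l = Y j"
      using that by (intro feasible_eq[OF feasible])
    moreover have "W (- cnj (x j)) = \<tau> (Y l)"
      unfolding W_def l_def using False by (simp only: if_False)
    ultimately show ?thesis by simp
  qed
  have finite_V: "finite V"
    by (simp add: V_def)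
  have V_reflect: "- cnj v \<in> V" if "v \<in> V" for v
    using that by (auto simp: V_def)
  have W: "W v \<in> carrier_mat m m" if "v \<in> V" for v
    using that Y W_node W_reflected_node \<tau>_carrier by (auto simp: V_def)
  have W_reflect: "W (- cnj v) = \<tau> (W v)" if "v \<in> V" for v
    using that W_node W_reflected_node \<tau>_\<tau> by (auto simp: V_def)
  have r: "r j < p" if "j < n" for j
    using renumbering reduced that unfolding reduced_index_set_def
    by (auto dest: bij_betwE)
  have "V \<subseteq> (x \<circ> r) ` {..<n} \<union> (\<lambda>j. - cnj (x (r j))) ` {..<n}"
  proof -
    have "x j \<in> x ` S \<union> (\<lambda>j. - cnj (x j)) ` S \<and>
        - cnj (x j) \<in> x ` S \<union> (\<lambda>j. - cnj (x j)) ` S" if j: "j < p" for j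
    proof -
      obtain k where "k \<in> S" "x j = x k \<or> x j = - cnj (x k)"
        using reduced_index_set_covers[OF reduced j] .
      then show ?thesis by auto
    qed
    then show ?thesis
      using bij_betw_imp_surj_on[OF renumbering] by (auto simp: V_def)
  qed
  then have "card V \<le> card ((x \<circ> r) ` {..<n} \<union> (\<lambda>j. - cnj (x (r j))) ` {..<n})"
    by (intro card_mono) auto
  also have "\<dots> \<le> n + n"
    by (intro order_trans[OF card_Un_le] add_mono order_trans[OF card_image_le]) auto
  \<comment> \<open>\<open>card V\<close> serves as \<open>q\<close>; it drops below
    \<open>2 * n\<close> when a reduced node is purely imaginary and so equals its
    reflection.\<close>
  finally have card: "card V \<le> 2 * n" by simp
  have C_eq_0: "C k = 0\<^sub>m m m" if "card V \<le> k" for k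
    unfolding C_def using finite_V that by (rule lagrange_coeff_eq_0)
  have interpolates: "matpoly m (card V) C v = W v" if "v \<in> V" for v
    unfolding C_def using finite_V that W[OF that] by (rule matpoly_lagrange_coeff_node)
  have C_carrier: "C k \<in> carrier_mat m m" for k
    by (simp add: C_def lagrange_coeff_def)
  have "sharp (matpoly m (card V) C) s = A * matpoly m (card V) C s * B" for s
    unfolding C_def using finite_V V_reflect A(1) B(1) W W_reflect[unfolded \<tau>_def]
    by (rule sharp_matpoly_lagrange_coeff)
  moreover have "matpoly m (card V) C (x j) = Y j" if "j < p" for j
    using that interpolates W_node by (simp add: V_def)
  \<comment> \<open>Each block row states one interpolation condition. A purely imaginary node
    repeats a block row, so the system is verified for this \<open>C\<close> rather than solved by
    inverting the matrix.\<close>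
  moreover have "block_vandermonde m n (x \<circ> r) * coefficient_column m n C =
      data_column A B m n (Y \<circ> r)"
  proof -
    have "matpoly m (2 * n) C (if j < n then (x \<circ> r) j else - cnj ((x \<circ> r) (j - n))) =
        (if j < n then (Y \<circ> r) j else \<tau> ((Y \<circ> r) (j - n)))" if "j < 2 * n" for j
    proof -
      have "matpoly m (2 * n) C s = matpoly m (card V) C s" for s
        using card C_eq_0 by (intro matpoly_extend)
      moreover have "r (j - n) < p" if "\<not> j < n"
        using that \<open>j < 2 * n\<close> by (intro r) simp
      ultimately show ?thesis
        using r W_node W_reflected_node interpolates by (simp add: V_def)
    qed
    then show ?thesis
      unfolding block_vandermonde_mult_coefficient_column[OF C_carrier] data_column_def
        block_mat_def \<tau>_def
      by (intro cong_mat) (simp_all add: less_mult_imp_div_less)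
  qed
  ultimately show ?thesis
    using card C_eq_0 C_carrier by blast
qed

end
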